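(* Consider a chores Fisher market with $n$ agents and $m$ divisible chores, disutilities $d_{ij}>0$ and earning requirements $B_i>0$. The optimal value of the program $$\max_{\beta\ge0,\;p\ge0}\ \sum_j p_j-\sum_i B_i\log(\beta_i)\quad\text{s.t.}\quad p_j\le\beta_i d_{ij}\ \ \forall i\in[n],\,j\in[m],\qquad \sum_j p_j=\sum_i B_i$$ is at most $$\Big(\sum_i B_i\Big)\Big(1-\log\big(\textstyle\sum_i B_i\big)+\log\big(m\max_{i,j}d_{ij}\big)\Big).$$
   Context: Here $[k]=\{1,\dots,k\}$, $n,m\ge1$, $\beta\in\mathbb{R}^n_{\ge0}$, $p\in\mathbb{R}^m_{\ge0}$; $i$ ranges over $[n]$ and $j$ over $[m]$. The optimal value is the supremum of the objective over the feasible set. *)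

theory Defs
  imports "HOL-Analysis.Analysis"
begin

text \<open>
  Agents are indexed by the finite type \<open>'n\<close> and chores by \<open>'m\<close>, so the dimensions
  \<open>n, m \<ge> 1\<close> are \<open>CARD('n)\<close> and \<open>CARD('m)\<close>. The disutility of agent \<open>i\<close> for chore \<open>j\<close>
  is \<open>d $ i $ j\<close>.
\<close>

definition feasible_set ::
  "real ^ 'm ^ 'n \<Rightarrow> real ^ 'n \<Rightarrow> ((real ^ 'n) \<times> (real ^ 'm)) set" where
  "feasible_set d B =
     {(\<beta>, p). (\<forall>i. 0 \<le> \<beta> $ i) \<and> (\<forall>j. 0 \<le> p $ j) \<and>
              (\<forall>i j. p $ j \<le> \<beta> $ i * d $ i $ j) \<and>
              (\<Sum>j\<in>UNIV. p $ j) = (\<Sum>i\<in>UNIV. B $ i)}"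

text \<open>
  HOL sets \<open>ln 0 = 0\<close>. This value is never used on the feasible set when \<open>B > 0\<close>;
  see \<open>feasible_set_pos\<close> below.
\<close>

definition objective :: "real ^ 'n \<Rightarrow> real ^ 'n \<Rightarrow> real ^ 'm \<Rightarrow> real" where
  "objective B \<beta> p = (\<Sum>j\<in>UNIV. p $ j) - (\<Sum>i\<in>UNIV. B $ i * ln (\<beta> $ i))"

text \<open>
  The supremum is taken in the extended reals, where it is meaningful
  without presupposing that the objective is bounded above.
\<close>

definition optimal_value :: "real ^ 'm ^ 'n \<Rightarrow> real ^ 'n \<Rightarrow> ereal" where
  "optimal_value d B = (SUP (\<beta>, p) \<in> feasible_set d B. ereal (objective B \<beta> p))"

lemma feasible_set_pos:
  fixes d :: "real ^ 'm ^ 'n" and B :: "real ^ 'n"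
  assumes B: "\<And>i. B $ i > 0" and feas: "(\<beta>, p) \<in> feasible_set d B"
  shows "\<beta> $ i > 0"
proof (rule ccontr)
  assume "\<not> \<beta> $ i > 0"
  with feas have "\<beta> $ i = 0"
    unfolding feasible_set_def by (auto simp: not_less intro: order_antisym)
  moreover have "p $ j \<le> \<beta> $ i * d $ i $ j" for j
    using feas unfolding feasible_set_def by auto
  ultimately have "p $ j \<le> 0" for j
    by simp
  then have "(\<Sum>j\<in>UNIV. p $ j) \<le> 0"
    by (intro sum_nonpos) auto
  moreover have "(\<Sum>i\<in>UNIV. B $ i) > 0"
    using B by (intro sum_pos) auto
  ultimately show False
    using feas unfolding feasible_set_def by auto
qed

end

theory Submission
  imports Defs
begin

text \<open>
  Summing \<open>p\<^sub>j \<le> \<beta>\<^sub>i d\<^sub>i\<^sub>j\<close> over \<open>j\<close> bounds every \<open>\<beta>\<^sub>i\<close> from below by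
  \<open>(\<Sum>\<^sub>k B\<^sub>k) / (m max d)\<close>; taking logarithms and averaging with weights \<open>B\<^sub>i\<close> gives
  the claim.
\<close>

lemma feasible_sum_le:
  fixes d :: "real ^ 'm ^ 'n" and B :: "real ^ 'n"
  assumes feas: "(\<beta>, p) \<in> feasible_set d B"
  shows "(\<Sum>k\<in>UNIV. B $ k) \<le> \<beta> $ i * (real CARD('m) * Max (range (\<lambda>(i, j). d $ i $ j)))"
proof -
  let ?D = "Max (range (\<lambda>(i, j). d $ i $ j))"
  have "d $ i $ j \<le> ?D" for j
    by (rule Max_ge) (auto intro: image_eqI[of _ _ "(i, j)"])
  then have "\<beta> $ i * d $ i $ j \<le> \<beta> $ i * ?D" for j
    using feas unfolding feasible_set_def by (intro mult_left_mono) auto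
  moreover have "p $ j \<le> \<beta> $ i * d $ i $ j" for j
    using feas unfolding feasible_set_def by auto
  ultimately have "p $ j \<le> \<beta> $ i * ?D" for j
    using order_trans by blast
  then have "(\<Sum>j\<in>UNIV. p $ j) \<le> (\<Sum>j\<in>(UNIV :: 'm set). \<beta> $ i * ?D)"
    by (intro sum_mono)
  \<comment> \<open>The budget constraint turns the left sum into the total of \<open>B\<close>; the
    right sum has a constant summand, which produces the factor \<open>CARD('m)\<close>.\<close>
  then show ?thesis
    using feas unfolding feasible_set_def by (simp add: mult_ac)
qed

theorem lemma1:
  fixes d :: "real ^ 'm ^ 'n" and B :: "real ^ 'n"
  assumes "\<And>i j. d $ i $ j > 0"
    and "\<And>i. B $ i > 0"
  shows "optimal_value d B \<le>
    ereal ((\<Sum>i\<in>UNIV. B $ i) *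
      (1 - ln (\<Sum>i\<in>UNIV. B $ i) +
       ln (real CARD('m) * Max (range (\<lambda>(i, j). d $ i $ j)))))"
proof -
  define S where "S = (\<Sum>i\<in>UNIV. B $ i)"
  define M where "M = real CARD('m) * Max (range (\<lambda>(i, j). d $ i $ j))"
  have S: "S > 0"
    unfolding S_def using assms(2) by (intro sum_pos) auto
  \<comment> \<open>A maximum over a finite nonempty range is attained, so it is an entry of
    \<open>d\<close> and inherits positivity.\<close>
  have "Max (range (\<lambda>(i, j). d $ i $ j)) \<in> range (\<lambda>(i, j). d $ i $ j)"
    by (rule Max_in) auto
  then obtain i j where "Max (range (\<lambda>(i, j). d $ i $ j)) = d $ i $ j"
    by (elim rangeE) (auto split: prod.splits)
  then have M: "M > 0"
    unfolding M_def using assms(1) by simp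
  have "objective B \<beta> p \<le> S * (1 - ln S + ln M)"
    if feas: "(\<beta>, p) \<in> feasible_set d B" for \<beta> p
  proof -
    have "ln S - ln M \<le> ln (\<beta> $ i)" for i
    proof -
      \<comment> \<open>Together with \<open>M > 0\<close> this lets
        \<open>ln (\<beta> $ i * M)\<close> split into a sum, away from the default
        \<open>ln 0 = 0\<close>.\<close>
      have \<beta>: "\<beta> $ i > 0"
        using assms(2) feas by (rule feasible_set_pos)
      have "ln S \<le> ln (\<beta> $ i * M)"
        using feasible_sum_le[OF feas, of i] S unfolding S_def M_def by (intro ln_mono)
      then show ?thesis
        using \<beta> M by (simp add: ln_mult)
    qed
    then have "(\<Sum>i\<in>UNIV. B $ i * (ln S - ln M)) \<le> (\<Sum>i\<in>UNIV. B $ i * ln (\<beta> $ i))"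
      using assms(2) by (intro sum_mono mult_left_mono) (auto intro: less_imp_le)
    then have "S * (ln S - ln M) \<le> (\<Sum>i\<in>UNIV. B $ i * ln (\<beta> $ i))"
      unfolding S_def by (simp add: sum_distrib_right)
    \<comment> \<open>The linear part of the objective is constant on the feasible set; it
      contributes the summand 1 in the bound.\<close>
    moreover have "(\<Sum>j\<in>UNIV. p $ j) = S"
      using feas unfolding feasible_set_def S_def by auto
    ultimately show ?thesis
      unfolding objective_def by (simp add: algebra_simps)
  qed
  \<comment> \<open>The bound is uniform over feasible pairs, so it passes to the supremum in
    \<open>ereal\<close>.\<close>
  then show ?thesis
    unfolding optimal_value_def S_def M_def by (auto intro!: SUP_least)
qed

end
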